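(* Let $(T,u,m)$ and $(P,\eta,\mu)$ be monads on a category $\mathscr C$. Distributive laws $\lambda\colon TP\to PT$ of $T$ over $P$ are in bijection, via $\lambda\mapsto\alpha:=Pm\cdot\lambda T$, with natural transformations $\alpha\colon TPT\to PT$ satisfying the three equations $$\alpha\cdot uPT=\mathrm{id}_{PT},\qquad \alpha\cdot T\eta T=\eta T\cdot m,\qquad \alpha\cdot T\mu T\cdot TP\alpha=\mu T\cdot P\alpha\cdot\alpha PT .$$
   Context: Composition of natural transformations is written $\cdot$ (right to left), whiskering by juxtaposition. A distributive law of $T$ over $P$ (Beck) is a natural transformation $\lambda\colon TP\to PT$ such that $\lambda\cdot uP=Pu$, $\lambda\cdot T\eta=\eta T$, $\lambda\cdot mP=Pm\cdot\lambda T\cdot T\lambda$ and $\lambda\cdot T\mu=\mu T\cdot P\lambda\cdot\lambda P$. *)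

theory Defs
  imports Main "HOL-Library.FuncSet"
begin

record ('o, 'a) category_data =
  Obj :: "'o set"
  Arr :: "'a set"
  Src :: "'a \<Rightarrow> 'o"
  Tgt :: "'a \<Rightarrow> 'o"
  Ident :: "'o \<Rightarrow> 'a" ("\<one>\<index>")
  Comp :: "'a \<Rightarrow> 'a \<Rightarrow> 'a" (infixr "\<odot>\<index>" 70)

definition hom :: "('o, 'a) category_data \<Rightarrow> 'o \<Rightarrow> 'o \<Rightarrow> 'a set" where
  "hom C X Y = {f \<in> Arr C. Src C f = X \<and> Tgt C f = Y}"

locale category =
  fixes C :: "('o, 'a) category_data" (structure)
  assumes src_closed: "f \<in> Arr C \<Longrightarrow> Src C f \<in> Obj C"
    and tgt_closed: "f \<in> Arr C \<Longrightarrow> Tgt C f \<in> Obj C"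
    and ident_hom: "X \<in> Obj C \<Longrightarrow> \<one> X \<in> hom C X X"
    and comp_hom: "f \<in> hom C X Y \<Longrightarrow> g \<in> hom C Y Z \<Longrightarrow> g \<odot> f \<in> hom C X Z"
    and comp_ident: "f \<in> hom C X Y \<Longrightarrow> f \<odot> \<one> X = f"
    and ident_comp: "f \<in> hom C X Y \<Longrightarrow> \<one> Y \<odot> f = f"
    and comp_assoc: "f \<in> hom C W X \<Longrightarrow> g \<in> hom C X Y \<Longrightarrow> h \<in> hom C Y Z
      \<Longrightarrow> (h \<odot> g) \<odot> f = h \<odot> (g \<odot> f)"

record ('o, 'a) functor_data =
  obj_map :: "'o \<Rightarrow> 'o"
  arr_map :: "'a \<Rightarrow> 'a"

locale endofunctor = category C
  for C :: "('o, 'a) category_data" (structure) +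
  fixes F :: "('o, 'a) functor_data"
  assumes obj_map_closed: "X \<in> Obj C \<Longrightarrow> obj_map F X \<in> Obj C"
    and arr_map_hom: "f \<in> hom C X Y \<Longrightarrow> arr_map F f \<in> hom C (obj_map F X) (obj_map F Y)"
    and arr_map_ident: "X \<in> Obj C \<Longrightarrow> arr_map F (\<one> X) = \<one> (obj_map F X)"
    and arr_map_comp: "f \<in> hom C X Y \<Longrightarrow> g \<in> hom C Y Z
      \<Longrightarrow> arr_map F (g \<odot> f) = arr_map F g \<odot> arr_map F f"

definition id_functor :: "('o, 'a) functor_data" where
  "id_functor = \<lparr>obj_map = \<lambda>X. X, arr_map = \<lambda>f. f\<rparr>"

definition functor_comp ::
  "('o, 'a) functor_data \<Rightarrow> ('o, 'a) functor_data \<Rightarrow> ('o, 'a) functor_data"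
  (infixr "\<circ>\<^sub>F" 80) where
  "F \<circ>\<^sub>F G = \<lparr>obj_map = \<lambda>X. obj_map F (obj_map G X), arr_map = \<lambda>f. arr_map F (arr_map G f)\<rparr>"

text \<open>
  A natural transformation is the family of its components. The family is required to be
  \<open>undefined\<close> outside the objects of the category, so that equality of natural
  transformations is HOL equality; the operations below restrict accordingly.
\<close>

locale nat_trans = category C + F: endofunctor C F + G: endofunctor C G
  for C :: "('o, 'a) category_data" (structure)
    and F G :: "('o, 'a) functor_data" +
  fixes t :: "'o \<Rightarrow> 'a"
  assumes extensional: "t \<in> extensional (Obj C)"
    and component_hom: "X \<in> Obj C \<Longrightarrow> t X \<in> hom C (obj_map F X) (obj_map G X)"
    and naturality: "f \<in> hom C X Y \<Longrightarrow> t Y \<odot> arr_map F f = arr_map G f \<odot> t X"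

definition id_trans :: "('o, 'a) category_data \<Rightarrow> ('o, 'a) functor_data \<Rightarrow> 'o \<Rightarrow> 'a" where
  "id_trans C F = (\<lambda>X\<in>Obj C. Ident C (obj_map F X))"

definition vert_comp ::
  "('o, 'a) category_data \<Rightarrow> ('o \<Rightarrow> 'a) \<Rightarrow> ('o \<Rightarrow> 'a) \<Rightarrow> 'o \<Rightarrow> 'a" (infixr "\<cdot>\<index>" 65) where
  "vert_comp C t s = (\<lambda>X\<in>Obj C. Comp C (t X) (s X))"

text \<open>\<open>F \<triangleright> t\<close> is the whiskering usually written \<open>Ft\<close>, and \<open>t \<triangleleft> F\<close> the one written \<open>tF\<close>.\<close>

definition whisker_left ::
  "('o, 'a) category_data \<Rightarrow> ('o, 'a) functor_data \<Rightarrow> ('o \<Rightarrow> 'a) \<Rightarrow> 'o \<Rightarrow> 'a"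
  (infixr "\<triangleright>\<index>" 75) where
  "whisker_left C F t = (\<lambda>X\<in>Obj C. arr_map F (t X))"

definition whisker_right ::
  "('o, 'a) category_data \<Rightarrow> ('o \<Rightarrow> 'a) \<Rightarrow> ('o, 'a) functor_data \<Rightarrow> 'o \<Rightarrow> 'a"
  (infixl "\<triangleleft>\<index>" 75) where
  "whisker_right C t F = (\<lambda>X\<in>Obj C. t (obj_map F X))"

locale monad = endofunctor C T +
    unit: nat_trans C id_functor T u + mult: nat_trans C "T \<circ>\<^sub>F T" T m
  for C :: "('o, 'a) category_data" (structure)
    and T :: "('o, 'a) functor_data"
    and u m :: "'o \<Rightarrow> 'a" +
  assumes left_unit: "m \<cdot> (u \<triangleleft> T) = id_trans C T"
    and right_unit: "m \<cdot> (T \<triangleright> u) = id_trans C T"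
    and mult_assoc: "m \<cdot> (T \<triangleright> m) = m \<cdot> (m \<triangleleft> T)"

locale distributive_law =
    T: monad C T u m + P: monad C P \<eta> \<mu> + nat_trans C "T \<circ>\<^sub>F P" "P \<circ>\<^sub>F T" l
  for C :: "('o, 'a) category_data" (structure)
    and T :: "('o, 'a) functor_data"
    and u m :: "'o \<Rightarrow> 'a"
    and P :: "('o, 'a) functor_data"
    and \<eta> \<mu> l :: "'o \<Rightarrow> 'a" +
  assumes unit_T: "l \<cdot> (u \<triangleleft> P) = P \<triangleright> u"
    and unit_P: "l \<cdot> (T \<triangleright> \<eta>) = \<eta> \<triangleleft> T"
    and mult_T: "l \<cdot> (m \<triangleleft> P) = (P \<triangleright> m) \<cdot> (l \<triangleleft> T) \<cdot> (T \<triangleright> l)"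
    and mult_P: "l \<cdot> (T \<triangleright> \<mu>) = (\<mu> \<triangleleft> T) \<cdot> (P \<triangleright> l) \<cdot> (l \<triangleleft> P)"

end

theory Submission
  imports Defs
begin

text \<open>
  The inverse of \<open>\<lambda> \<mapsto> Pm \<cdot> \<lambda>T\<close> is \<open>\<alpha> \<mapsto> \<alpha> \<cdot> TPu\<close>. Precomposing the third equation on \<open>\<alpha>\<close> with
  \<open>T\<eta>TPT\<close> shows that \<open>\<alpha>\<close> is associative, \<open>\<alpha> \<cdot> T\<alpha> = \<alpha> \<cdot> mPT\<close>; precomposing it with \<open>TPT\<eta>T\<close>
  shows that \<open>\<alpha>\<close> is right \<open>T\<close>-linear, \<open>\<alpha> \<cdot> TPm = Pm \<cdot> \<alpha>T\<close>. These two identities give the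
  compatibility of \<open>\<alpha> \<cdot> TPu\<close> with \<open>m\<close>, and the second one also gives the bijection.
\<close>

section \<open>Rewriting with arrows, functors and components\<close>

lemma functor_comp_simps [simp]:
  "obj_map (F \<circ>\<^sub>F G) X = obj_map F (obj_map G X)"
  "arr_map (F \<circ>\<^sub>F G) f = arr_map F (arr_map G f)"
  by (simp_all add: functor_comp_def)

lemma id_functor_simps [simp]:
  "obj_map id_functor X = X"
  "arr_map id_functor f = f"
  by (simp_all add: id_functor_def)

text \<open>The operations on transformations are all restrictions to \<open>Obj C\<close>, so this
  reduces an equation of transformations to one equation of arrows per object.\<close>

lemma restrict_eq_iff: "restrict f A = restrict g A \<longleftrightarrow> (\<forall>x\<in>A. f x = g x)"
  by (metis restrict_apply' restrict_ext)

context category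
begin

lemma arr_simps [simp]:
  "f \<in> Arr C \<Longrightarrow> Src C f \<in> Obj C"
  "f \<in> Arr C \<Longrightarrow> Tgt C f \<in> Obj C"
  by (fact src_closed tgt_closed)+

lemma ident_simps [simp]:
  assumes "X \<in> Obj C"
  shows "\<one> X \<in> Arr C" "Src C (\<one> X) = X" "Tgt C (\<one> X) = X"
  using ident_hom[OF assms] by (simp_all add: hom_def)

text \<open>The premises use \<open>Src\<close> and \<open>Tgt\<close> instead of
  \<open>hom\<close>, so that the simplifier checks composability by evaluation and need not guess
  an intermediate object.\<close>

lemma comp_simps [simp]:
  assumes "f \<in> Arr C" "g \<in> Arr C" "Tgt C f = Src C g"
  shows "g \<odot> f \<in> Arr C" "Src C (g \<odot> f) = Src C f" "Tgt C (g \<odot> f) = Tgt C g"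
  using comp_hom[of f "Src C f" "Src C g" g "Tgt C g"] assms by (simp_all add: hom_def)

lemma comp_ident_simps [simp]:
  "f \<in> Arr C \<Longrightarrow> X = Src C f \<Longrightarrow> f \<odot> \<one> X = f"
  "f \<in> Arr C \<Longrightarrow> X = Tgt C f \<Longrightarrow> \<one> X \<odot> f = f"
  using comp_ident ident_comp by (auto simp: hom_def)

lemma comp_assoc_simp [simp]:
  assumes "f \<in> Arr C" "g \<in> Arr C" "h \<in> Arr C" "Tgt C f = Src C g" "Tgt C g = Src C h"
  shows "(h \<odot> g) \<odot> f = h \<odot> (g \<odot> f)"
  using assms by (intro comp_assoc) (auto simp: hom_def)

text \<open>Simplification nests composites to the right, which hides the product
  \<open>g \<odot> f\<close> as soon as a further factor \<open>k\<close> stands to its right. This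
  form of the equation still matches there.\<close>

lemma comp_eq_comp:
  assumes "g \<odot> f = h" "f \<in> Arr C" "g \<in> Arr C" "k \<in> Arr C" "Tgt C f = Src C g" "Tgt C k = Src C f"
  shows "g \<odot> (f \<odot> k) = h \<odot> k"
  using assms comp_assoc_simp by metis

end

context endofunctor
begin

lemma functor_simps [simp]:
  "X \<in> Obj C \<Longrightarrow> obj_map F X \<in> Obj C"
  "f \<in> Arr C \<Longrightarrow> arr_map F f \<in> Arr C"
  "f \<in> Arr C \<Longrightarrow> Src C (arr_map F f) = obj_map F (Src C f)"
  "f \<in> Arr C \<Longrightarrow> Tgt C (arr_map F f) = obj_map F (Tgt C f)"
  "X \<in> Obj C \<Longrightarrow> arr_map F (\<one> X) = \<one> (obj_map F X)"
  using obj_map_closed arr_map_hom arr_map_ident by (simp_all add: hom_def)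

lemma functor_comp_simp [simp]:
  assumes "f \<in> Arr C" "g \<in> Arr C" "Tgt C f = Src C g"
  shows "arr_map F (g \<odot> f) = arr_map F g \<odot> arr_map F f"
  using assms by (intro arr_map_comp) (auto simp: hom_def)

end

lemma endofunctor_comp:
  fixes C (structure)
  assumes "endofunctor C F" "endofunctor C G"
  shows "endofunctor C (F \<circ>\<^sub>F G)"
proof -
  interpret F: endofunctor C F by fact
  interpret G: endofunctor C G by fact
  show ?thesis
    by unfold_locales (auto simp: hom_def)
qed

context nat_trans
begin

lemma component_simps [simp]:
  assumes "X \<in> Obj C"
  shows "t X \<in> Arr C" "Src C (t X) = obj_map F X" "Tgt C (t X) = obj_map G X"
  using component_hom[OF assms] by (simp_all add: hom_def)

lemma natural:
  assumes "f \<in> Arr C" "Src C f = X" "Tgt C f = Y"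
  shows "t Y \<odot> arr_map F f = arr_map G f \<odot> t X"
  using assms by (intro naturality) (simp add: hom_def)

end

lemma nat_transI:
  fixes C (structure)
  assumes "endofunctor C F" "endofunctor C G" "t \<in> extensional (Obj C)"
    and "\<And>X. X \<in> Obj C \<Longrightarrow> t X \<in> Arr C \<and> Src C (t X) = obj_map F X \<and> Tgt C (t X) = obj_map G X"
    and "\<And>f. f \<in> Arr C \<Longrightarrow> t (Tgt C f) \<odot> arr_map F f = arr_map G f \<odot> t (Src C f)"
  shows "nat_trans C F G t"
proof -
  interpret F: endofunctor C F by fact
  show ?thesis
    using assms by unfold_locales (auto simp: hom_def endofunctor_def endofunctor_axioms_def)
qed

lemmas trans_defs =
  vert_comp_def whisker_left_def whisker_right_def id_trans_def restrict_eq_iff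

context monad
begin

lemma monad_laws:
  assumes "X \<in> Obj C"
  shows "m X \<odot> u (obj_map T X) = \<one> (obj_map T X)"
    and "m X \<odot> arr_map T (u X) = \<one> (obj_map T X)"
    and "m X \<odot> arr_map T (m X) = m X \<odot> m (obj_map T X)"
  using assms left_unit right_unit mult_assoc by (auto simp: trans_defs)

end

section \<open>Pairs of monads and consequences of the equations on \<alpha>\<close>

locale monad_pair =
  category C + T: monad C T u m + P: monad C P \<eta> \<mu>
  for C :: "('o, 'a) category_data" (structure)
    and T :: "('o, 'a) functor_data"
    and u m :: "'o \<Rightarrow> 'a"
    and P :: "('o, 'a) functor_data"
    and \<eta> \<mu> :: "'o \<Rightarrow> 'a"
begin

abbreviation "T\<^sub>0 \<equiv> obj_map T"
abbreviation "T\<^sub>1 \<equiv> arr_map T"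
abbreviation "P\<^sub>0 \<equiv> obj_map P"
abbreviation "P\<^sub>1 \<equiv> arr_map P"

end

locale law = monad_pair + distributive_law
begin

lemma law_components:
  assumes "X \<in> Obj C"
  shows "l X \<odot> u (P\<^sub>0 X) = P\<^sub>1 (u X)"
    and "l X \<odot> T\<^sub>1 (\<eta> X) = \<eta> (T\<^sub>0 X)"
    and "l X \<odot> m (P\<^sub>0 X) = P\<^sub>1 (m X) \<odot> l (T\<^sub>0 X) \<odot> T\<^sub>1 (l X)"
    and "l X \<odot> T\<^sub>1 (\<mu> X) = \<mu> (T\<^sub>0 X) \<odot> P\<^sub>1 (l X) \<odot> l (P\<^sub>0 X)"
  using assms unit_T unit_P mult_T mult_P by (auto simp: trans_defs)

end

text \<open>Read \<open>\<alpha> X\<close> as an action of \<open>T\<close> on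
  \<open>P\<^sub>0 (T\<^sub>0 X)\<close>. The first equation is the unit axiom of an action, the
  second makes \<open>\<eta>T\<close> equivariant for the free action \<open>m\<close>, the third
  makes \<open>\<mu>T \<cdot> P\<alpha>\<close> equivariant. If \<alpha> comes from a distributive
  law, the latter map is the multiplication of the composite monad \<open>PT\<close>.\<close>

locale extension_law =
  monad_pair +
  nat_trans C "T \<circ>\<^sub>F P \<circ>\<^sub>F T" "P \<circ>\<^sub>F T" \<alpha> for \<alpha> +
  assumes unit: "\<alpha> \<cdot> (u \<triangleleft> (P \<circ>\<^sub>F T)) = id_trans C (P \<circ>\<^sub>F T)"
    and preserves_unit: "\<alpha> \<cdot> (T \<triangleright> (\<eta> \<triangleleft> T)) = (\<eta> \<triangleleft> T) \<cdot> m"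
    and preserves_extension: "\<alpha> \<cdot> (T \<triangleright> (\<mu> \<triangleleft> T)) \<cdot> ((T \<circ>\<^sub>F P) \<triangleright> \<alpha>)
          = (\<mu> \<triangleleft> T) \<cdot> (P \<triangleright> \<alpha>) \<cdot> (\<alpha> \<triangleleft> (P \<circ>\<^sub>F T))"
begin

lemma extension_components:
  assumes "X \<in> Obj C"
  shows "\<alpha> X \<odot> u (P\<^sub>0 (T\<^sub>0 X)) = \<one> (P\<^sub>0 (T\<^sub>0 X))"
    and "\<alpha> X \<odot> T\<^sub>1 (\<eta> (T\<^sub>0 X)) = \<eta> (T\<^sub>0 X) \<odot> m X"
    and "\<alpha> X \<odot> T\<^sub>1 (\<mu> (T\<^sub>0 X)) \<odot> T\<^sub>1 (P\<^sub>1 (\<alpha> X)) = \<mu> (T\<^sub>0 X) \<odot> P\<^sub>1 (\<alpha> X) \<odot> \<alpha> (P\<^sub>0 (T\<^sub>0 X))"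
  using assms unit preserves_unit preserves_extension by (auto simp: trans_defs)


text \<open>Insert \<open>T(\<mu> \<cdot> \<eta>P) = id\<close> at \<open>T\<^sub>0 X\<close> and
  slide \<eta> past \<alpha> by naturality: the left side of the third equation appears. On its
  right side the second equation turns \<alpha> after \<eta> into \<eta> after \<open>m\<close>;
  sliding \<eta> back lets it cancel against \<mu>.\<close>

lemma assoc:
  assumes [simp]: "X \<in> Obj C"
  shows "\<alpha> X \<odot> T\<^sub>1 (\<alpha> X) = \<alpha> X \<odot> m (P\<^sub>0 (T\<^sub>0 X))"
proof -
  let ?Y = "P\<^sub>0 (T\<^sub>0 X)"
  have 1: "T\<^sub>1 (\<mu> (T\<^sub>0 X)) \<odot> T\<^sub>1 (\<eta> ?Y) = \<one> (T\<^sub>0 ?Y)"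
    using arg_cong[OF P.monad_laws(1)[of "T\<^sub>0 X"], of T\<^sub>1] by simp
  have "\<alpha> X \<odot> T\<^sub>1 (\<alpha> X) = \<alpha> X \<odot> T\<^sub>1 (\<mu> (T\<^sub>0 X)) \<odot> T\<^sub>1 (\<eta> ?Y \<odot> \<alpha> X)"
    by (simp add: comp_eq_comp[OF 1])
  also have "\<dots> = \<alpha> X \<odot> T\<^sub>1 (\<mu> (T\<^sub>0 X)) \<odot> T\<^sub>1 (P\<^sub>1 (\<alpha> X) \<odot> \<eta> (T\<^sub>0 ?Y))"
    using P.unit.natural[of "\<alpha> X"] by simp
  also have "\<dots> = (\<alpha> X \<odot> T\<^sub>1 (\<mu> (T\<^sub>0 X)) \<odot> T\<^sub>1 (P\<^sub>1 (\<alpha> X))) \<odot> T\<^sub>1 (\<eta> (T\<^sub>0 ?Y))"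
    by simp
  also have "\<dots> = (\<mu> (T\<^sub>0 X) \<odot> P\<^sub>1 (\<alpha> X) \<odot> \<alpha> ?Y) \<odot> T\<^sub>1 (\<eta> (T\<^sub>0 ?Y))"
    by (simp only: extension_components(3) assms)
  also have "\<dots> = \<mu> (T\<^sub>0 X) \<odot> (P\<^sub>1 (\<alpha> X) \<odot> \<eta> (T\<^sub>0 ?Y)) \<odot> m ?Y"
    by (simp add: extension_components(2))
  also have "\<dots> = \<mu> (T\<^sub>0 X) \<odot> (\<eta> ?Y \<odot> \<alpha> X) \<odot> m ?Y"
    using P.unit.natural[of "\<alpha> X"] by simp
  also have "\<dots> = \<alpha> X \<odot> m ?Y"
    by (simp add: comp_eq_comp[OF P.monad_laws(1)])
  finally show ?thesis .
qed

text \<open>The same argument with the other unit law of \<open>P\<close>: \<eta> is inserted under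
  \<open>P\<close>, where \<open>\<eta>T \<cdot> m\<close> is replaced by
  \<open>\<alpha> \<cdot> T\<eta>T\<close>. After the third equation, naturality of \<alpha> at
  \<eta> and the second equation restore \<open>\<eta>T \<cdot> m\<close> under \<open>P\<close>,
  and \<mu> absorbs the \<eta>.\<close>

lemma linear:
  assumes [simp]: "X \<in> Obj C"
  shows "\<alpha> X \<odot> T\<^sub>1 (P\<^sub>1 (m X)) = P\<^sub>1 (m X) \<odot> \<alpha> (T\<^sub>0 X)"
proof -
  let ?Y = "P\<^sub>0 (T\<^sub>0 X)"
  have 1: "T\<^sub>1 (\<mu> (T\<^sub>0 X)) \<odot> T\<^sub>1 (P\<^sub>1 (\<eta> (T\<^sub>0 X))) = \<one> (T\<^sub>0 ?Y)"
    using arg_cong[OF P.monad_laws(2)[of "T\<^sub>0 X"], of T\<^sub>1] by simp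
  have "\<alpha> X \<odot> T\<^sub>1 (P\<^sub>1 (m X)) = \<alpha> X \<odot> T\<^sub>1 (\<mu> (T\<^sub>0 X)) \<odot> T\<^sub>1 (P\<^sub>1 (\<eta> (T\<^sub>0 X) \<odot> m X))"
    by (simp add: comp_eq_comp[OF 1])
  also have "\<dots> = \<alpha> X \<odot> T\<^sub>1 (\<mu> (T\<^sub>0 X)) \<odot> T\<^sub>1 (P\<^sub>1 (\<alpha> X \<odot> T\<^sub>1 (\<eta> (T\<^sub>0 X))))"
    by (simp only: extension_components(2) assms)
  also have "\<dots> = (\<alpha> X \<odot> T\<^sub>1 (\<mu> (T\<^sub>0 X)) \<odot> T\<^sub>1 (P\<^sub>1 (\<alpha> X))) \<odot> T\<^sub>1 (P\<^sub>1 (T\<^sub>1 (\<eta> (T\<^sub>0 X))))"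
    by simp
  also have "\<dots> = (\<mu> (T\<^sub>0 X) \<odot> P\<^sub>1 (\<alpha> X) \<odot> \<alpha> ?Y) \<odot> T\<^sub>1 (P\<^sub>1 (T\<^sub>1 (\<eta> (T\<^sub>0 X))))"
    by (simp only: extension_components(3) assms)
  also have "\<dots> = \<mu> (T\<^sub>0 X) \<odot> P\<^sub>1 (\<alpha> X \<odot> T\<^sub>1 (\<eta> (T\<^sub>0 X))) \<odot> \<alpha> (T\<^sub>0 X)"
    using natural[of "\<eta> (T\<^sub>0 X)"] by simp
  also have "\<dots> = \<mu> (T\<^sub>0 X) \<odot> P\<^sub>1 (\<eta> (T\<^sub>0 X) \<odot> m X) \<odot> \<alpha> (T\<^sub>0 X)"
    by (simp only: extension_components(2) assms)
  also have "\<dots> = P\<^sub>1 (m X) \<odot> \<alpha> (T\<^sub>0 X)"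
    by (simp add: comp_eq_comp[OF P.monad_laws(2)])
  finally show ?thesis .
qed

section \<open>From \<alpha> to a distributive law\<close>

definition to_law where "to_law = \<alpha> \<cdot> ((T \<circ>\<^sub>F P) \<triangleright> u)"

lemma to_law_component: "X \<in> Obj C \<Longrightarrow> to_law X = \<alpha> X \<odot> T\<^sub>1 (P\<^sub>1 (u X))"
  by (simp add: to_law_def trans_defs)

lemma to_law_nat_trans: "nat_trans C (T \<circ>\<^sub>F P) (P \<circ>\<^sub>F T) to_law"
proof (rule nat_transI)
  fix f assume [simp]: "f \<in> Arr C"
  have "to_law (Tgt C f) \<odot> T\<^sub>1 (P\<^sub>1 f) = \<alpha> (Tgt C f) \<odot> T\<^sub>1 (P\<^sub>1 (u (Tgt C f) \<odot> f))"
    by (simp add: to_law_component)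
  also have "\<dots> = \<alpha> (Tgt C f) \<odot> T\<^sub>1 (P\<^sub>1 (T\<^sub>1 f \<odot> u (Src C f)))"
    using T.unit.natural[of f] by simp
  also have "\<dots> = (\<alpha> (Tgt C f) \<odot> T\<^sub>1 (P\<^sub>1 (T\<^sub>1 f))) \<odot> T\<^sub>1 (P\<^sub>1 (u (Src C f)))"
    by simp
  also have "\<dots> = P\<^sub>1 (T\<^sub>1 f) \<odot> to_law (Src C f)"
    using natural[of f] by (simp add: to_law_component)
  finally show "to_law (Tgt C f) \<odot> arr_map (T \<circ>\<^sub>F P) f = arr_map (P \<circ>\<^sub>F T) f \<odot> to_law (Src C f)"
    by simp
qed (auto intro!: endofunctor_comp T.endofunctor_axioms P.endofunctor_axioms
      simp: to_law_component, simp add: to_law_def vert_comp_def)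

text \<open>The two unit axioms come from the first two equations on \<alpha>, compatibility with
  \<open>m\<close> from \<open>assoc\<close> and \<open>linear\<close>, and compatibility with \<mu>
  from the third equation.\<close>

lemma to_law_distributive: "distributive_law C T u m P \<eta> \<mu> to_law"
proof -
  interpret L: nat_trans C "T \<circ>\<^sub>F P" "P \<circ>\<^sub>F T" to_law
    by (rule to_law_nat_trans)
  have unit_T: "to_law X \<odot> u (P\<^sub>0 X) = P\<^sub>1 (u X)" if [simp]: "X \<in> Obj C" for X
  proof -
    have "to_law X \<odot> u (P\<^sub>0 X) = \<alpha> X \<odot> u (P\<^sub>0 (T\<^sub>0 X)) \<odot> P\<^sub>1 (u X)"
      using T.unit.natural[of "P\<^sub>1 (u X)"] by (simp add: to_law_component)
    then show ?thesis
      by (simp add: comp_eq_comp[OF extension_components(1)])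
  qed
  have unit_P: "to_law X \<odot> T\<^sub>1 (\<eta> X) = \<eta> (T\<^sub>0 X)" if [simp]: "X \<in> Obj C" for X
  proof -
    have "to_law X \<odot> T\<^sub>1 (\<eta> X) = \<alpha> X \<odot> T\<^sub>1 (P\<^sub>1 (u X) \<odot> \<eta> X)"
      by (simp add: to_law_component)
    also have "\<dots> = \<alpha> X \<odot> T\<^sub>1 (\<eta> (T\<^sub>0 X) \<odot> u X)"
      using P.unit.natural[of "u X"] by simp
    also have "\<dots> = \<eta> (T\<^sub>0 X)"
      by (simp add: comp_eq_comp[OF extension_components(2)] T.monad_laws(2))
    finally show ?thesis .
  qed
  have mult_T: "to_law X \<odot> m (P\<^sub>0 X) = P\<^sub>1 (m X) \<odot> to_law (T\<^sub>0 X) \<odot> T\<^sub>1 (to_law X)"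
    if [simp]: "X \<in> Obj C" for X
  proof -
    \<comment> \<open>Inserted behind \<open>\<alpha> X\<close>, this identity supplies the factor
      \<open>TPm\<close> that \<open>linear\<close> moves to the front; the remaining
      \<open>TPu\<close> completes \<open>to_law\<close> at \<open>T\<^sub>0 X\<close>.\<close>
    have 1: "T\<^sub>1 (P\<^sub>1 (m X)) \<odot> T\<^sub>1 (P\<^sub>1 (u (T\<^sub>0 X))) = \<one> (T\<^sub>0 (P\<^sub>0 (T\<^sub>0 X)))"
      using arg_cong[OF T.monad_laws(1)[of X], of "\<lambda>f. T\<^sub>1 (P\<^sub>1 f)"] by simp
    have "to_law X \<odot> m (P\<^sub>0 X) = (\<alpha> X \<odot> m (P\<^sub>0 (T\<^sub>0 X))) \<odot> T\<^sub>1 (T\<^sub>1 (P\<^sub>1 (u X)))"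
      using T.mult.natural[of "P\<^sub>1 (u X)"] by (simp add: to_law_component)
    also have "\<dots> = \<alpha> X \<odot> T\<^sub>1 (to_law X)"
      unfolding assoc[OF that, symmetric] by (simp add: to_law_component)
    also have "\<dots> = (\<alpha> X \<odot> T\<^sub>1 (P\<^sub>1 (m X))) \<odot> T\<^sub>1 (P\<^sub>1 (u (T\<^sub>0 X))) \<odot> T\<^sub>1 (to_law X)"
      by (simp add: comp_eq_comp[OF 1])
    also have "\<dots> = P\<^sub>1 (m X) \<odot> to_law (T\<^sub>0 X) \<odot> T\<^sub>1 (to_law X)"
      unfolding linear[OF that] by (simp add: to_law_component)
    finally show ?thesis .
  qed
  have mult_P: "to_law X \<odot> T\<^sub>1 (\<mu> X) = \<mu> (T\<^sub>0 X) \<odot> P\<^sub>1 (to_law X) \<odot> to_law (P\<^sub>0 X)"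
    if [simp]: "X \<in> Obj C" for X
  proof -
    let ?Y = "P\<^sub>0 (T\<^sub>0 X)"
    \<comment> \<open>The first equation on \<alpha>, under \<open>TP\<close>: it creates the factor
      \<open>TP\<alpha>\<close> that the left side of the third equation requires.\<close>
    have 1: "T\<^sub>1 (P\<^sub>1 (\<alpha> X)) \<odot> T\<^sub>1 (P\<^sub>1 (u ?Y)) = \<one> (T\<^sub>0 (P\<^sub>0 ?Y))"
      using arg_cong[OF extension_components(1)[of X], of "\<lambda>f. T\<^sub>1 (P\<^sub>1 f)"] by simp
    have "to_law X \<odot> T\<^sub>1 (\<mu> X) = \<alpha> X \<odot> T\<^sub>1 (P\<^sub>1 (u X) \<odot> \<mu> X)"
      by (simp add: to_law_component)
    also have "\<dots> = \<alpha> X \<odot> T\<^sub>1 (\<mu> (T\<^sub>0 X) \<odot> P\<^sub>1 (P\<^sub>1 (u X)))"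
      using P.mult.natural[of "u X"] by simp
    also have "\<dots> = (\<alpha> X \<odot> T\<^sub>1 (\<mu> (T\<^sub>0 X)) \<odot> T\<^sub>1 (P\<^sub>1 (\<alpha> X))) \<odot> T\<^sub>1 (P\<^sub>1 (u ?Y \<odot> P\<^sub>1 (u X)))"
      by (simp add: comp_eq_comp[OF 1])
    also have "\<dots> = (\<mu> (T\<^sub>0 X) \<odot> P\<^sub>1 (\<alpha> X) \<odot> \<alpha> ?Y) \<odot> T\<^sub>1 (P\<^sub>1 (T\<^sub>1 (P\<^sub>1 (u X)) \<odot> u (P\<^sub>0 X)))"
      using T.unit.natural[of "P\<^sub>1 (u X)"] by (simp only: extension_components(3) that) simp
    also have "\<dots> = \<mu> (T\<^sub>0 X) \<odot> P\<^sub>1 (\<alpha> X)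
        \<odot> (\<alpha> ?Y \<odot> T\<^sub>1 (P\<^sub>1 (T\<^sub>1 (P\<^sub>1 (u X))))) \<odot> T\<^sub>1 (P\<^sub>1 (u (P\<^sub>0 X)))"
      by simp
    also have "\<dots> = \<mu> (T\<^sub>0 X) \<odot> P\<^sub>1 (\<alpha> X)
        \<odot> (P\<^sub>1 (T\<^sub>1 (P\<^sub>1 (u X))) \<odot> \<alpha> (P\<^sub>0 X)) \<odot> T\<^sub>1 (P\<^sub>1 (u (P\<^sub>0 X)))"
      using natural[of "P\<^sub>1 (u X)"] by simp
    also have "\<dots> = \<mu> (T\<^sub>0 X) \<odot> P\<^sub>1 (to_law X) \<odot> to_law (P\<^sub>0 X)"
      by (simp add: to_law_component)
    finally show ?thesis .
  qed
  show ?thesis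
    by unfold_locales (auto simp: trans_defs unit_T unit_P mult_T mult_P)
qed

text \<open>By \<open>linear\<close>, \<open>Pm\<close> passes through \<alpha> and becomes
  \<open>TPm\<close>, which cancels \<open>TPu\<close> at \<open>T\<^sub>0 X\<close> by the left
  unit law of \<open>T\<close>. Both sides are \<open>undefined\<close> off the objects, so
  components suffice.\<close>

lemma to_law_inverse: "(P \<triangleright> m) \<cdot> (to_law \<triangleleft> T) = \<alpha>"
proof (rule extensionalityI[OF _ extensional])
  fix X assume [simp]: "X \<in> Obj C"
  have 1: "T\<^sub>1 (P\<^sub>1 (m X)) \<odot> T\<^sub>1 (P\<^sub>1 (u (T\<^sub>0 X))) = \<one> (T\<^sub>0 (P\<^sub>0 (T\<^sub>0 X)))"
    using arg_cong[OF T.monad_laws(1)[of X], of "\<lambda>f. T\<^sub>1 (P\<^sub>1 f)"] by simp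
  have "P\<^sub>1 (m X) \<odot> to_law (T\<^sub>0 X) = (\<alpha> X \<odot> T\<^sub>1 (P\<^sub>1 (m X))) \<odot> T\<^sub>1 (P\<^sub>1 (u (T\<^sub>0 X)))"
    unfolding linear[OF \<open>X \<in> Obj C\<close>] by (simp add: to_law_component)
  also have "\<dots> = \<alpha> X"
    by (simp add: 1)
  finally show "((P \<triangleright> m) \<cdot> (to_law \<triangleleft> T)) X = \<alpha> X"
    by (simp add: trans_defs)
qed (simp add: vert_comp_def)

end

section \<open>From a distributive law to \<alpha>\<close>

context law
begin

definition to_extension where "to_extension = (P \<triangleright> m) \<cdot> (l \<triangleleft> T)"

lemma to_extension_component: "X \<in> Obj C \<Longrightarrow> to_extension X = P\<^sub>1 (m X) \<odot> l (T\<^sub>0 X)"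
  by (simp add: to_extension_def trans_defs)

lemma to_extension_nat_trans: "nat_trans C (T \<circ>\<^sub>F P \<circ>\<^sub>F T) (P \<circ>\<^sub>F T) to_extension"
proof (rule nat_transI)
  fix f assume [simp]: "f \<in> Arr C"
  have "to_extension (Tgt C f) \<odot> T\<^sub>1 (P\<^sub>1 (T\<^sub>1 f)) = P\<^sub>1 (m (Tgt C f) \<odot> T\<^sub>1 (T\<^sub>1 f)) \<odot> l (T\<^sub>0 (Src C f))"
    using natural[of "T\<^sub>1 f"] by (simp add: to_extension_component)
  also have "\<dots> = P\<^sub>1 (T\<^sub>1 f \<odot> m (Src C f)) \<odot> l (T\<^sub>0 (Src C f))"
    using T.mult.natural[of f] by simp
  finally show "to_extension (Tgt C f) \<odot> arr_map (T \<circ>\<^sub>F P \<circ>\<^sub>F T) f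
      = arr_map (P \<circ>\<^sub>F T) f \<odot> to_extension (Src C f)"
    by (simp add: to_extension_component)
qed (auto intro!: endofunctor_comp T.endofunctor_axioms P.endofunctor_axioms
      simp: to_extension_component, simp add: to_extension_def vert_comp_def)

text \<open>The first two equations are the unit axioms of the law followed by
  \<open>m \<cdot> uT = id\<close> and by naturality of \<eta> at \<open>m\<close>. The third
  combines both multiplication axioms with associativity of \<open>m\<close>.\<close>

lemma to_extension_law: "extension_law C T u m P \<eta> \<mu> to_extension"
proof -
  interpret A: nat_trans C "T \<circ>\<^sub>F P \<circ>\<^sub>F T" "P \<circ>\<^sub>F T" to_extension
    by (rule to_extension_nat_trans)
  have unit: "to_extension X \<odot> u (P\<^sub>0 (T\<^sub>0 X)) = \<one> (P\<^sub>0 (T\<^sub>0 X))" if [simp]: "X \<in> Obj C" for X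
    using arg_cong[OF T.monad_laws(1)[of X], of P\<^sub>1]
    by (simp add: to_extension_component law_components(1))
  have preserves_unit: "to_extension X \<odot> T\<^sub>1 (\<eta> (T\<^sub>0 X)) = \<eta> (T\<^sub>0 X) \<odot> m X"
    if [simp]: "X \<in> Obj C" for X
    using P.unit.natural[of "m X"] by (simp add: to_extension_component law_components(2))
  have preserves_extension: "to_extension X \<odot> T\<^sub>1 (\<mu> (T\<^sub>0 X)) \<odot> T\<^sub>1 (P\<^sub>1 (to_extension X))
      = \<mu> (T\<^sub>0 X) \<odot> P\<^sub>1 (to_extension X) \<odot> to_extension (P\<^sub>0 (T\<^sub>0 X))"
    if [simp]: "X \<in> Obj C" for X
  proof -
    let ?Y = "P\<^sub>0 (T\<^sub>0 X)" and ?a = "to_extension X"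
    have "?a \<odot> T\<^sub>1 (\<mu> (T\<^sub>0 X)) \<odot> T\<^sub>1 (P\<^sub>1 ?a)
        = P\<^sub>1 (m X) \<odot> (l (T\<^sub>0 X) \<odot> T\<^sub>1 (\<mu> (T\<^sub>0 X))) \<odot> T\<^sub>1 (P\<^sub>1 ?a)"
      by (simp add: to_extension_component)
    also have "\<dots> = (P\<^sub>1 (m X) \<odot> \<mu> (T\<^sub>0 (T\<^sub>0 X))) \<odot> P\<^sub>1 (l (T\<^sub>0 X)) \<odot> (l ?Y \<odot> T\<^sub>1 (P\<^sub>1 ?a))"
      by (simp add: law_components(4))
    \<comment> \<open>Naturality of \<mu> at \<open>m X\<close> brings \<mu> to the front;
      naturality of \<open>l\<close> at \<open>?a\<close> collects everything between \<mu> and the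
      last \<open>l\<close> under \<open>P\<close>.\<close>
    also have "\<dots> = (\<mu> (T\<^sub>0 X) \<odot> P\<^sub>1 (P\<^sub>1 (m X))) \<odot> P\<^sub>1 (l (T\<^sub>0 X)) \<odot> (P\<^sub>1 (T\<^sub>1 ?a) \<odot> l (T\<^sub>0 ?Y))"
      using P.mult.natural[of "m X"] natural[of ?a] by simp
    also have "\<dots> = \<mu> (T\<^sub>0 X) \<odot> P\<^sub>1 (P\<^sub>1 (m X) \<odot> (l (T\<^sub>0 X) \<odot> T\<^sub>1 (P\<^sub>1 (m X))) \<odot> T\<^sub>1 (l (T\<^sub>0 X))) \<odot> l (T\<^sub>0 ?Y)"
      by (simp add: to_extension_component)
    \<comment> \<open>Naturality of \<open>l\<close> at \<open>m X\<close> makes the two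
      multiplications adjacent, ready for associativity.\<close>
    also have "\<dots> = \<mu> (T\<^sub>0 X)
        \<odot> P\<^sub>1 (P\<^sub>1 (m X \<odot> T\<^sub>1 (m X)) \<odot> l (T\<^sub>0 (T\<^sub>0 X)) \<odot> T\<^sub>1 (l (T\<^sub>0 X))) \<odot> l (T\<^sub>0 ?Y)"
      using natural[of "m X"] by simp
    also have "\<dots> = \<mu> (T\<^sub>0 X)
        \<odot> P\<^sub>1 (P\<^sub>1 (m X \<odot> m (T\<^sub>0 X)) \<odot> l (T\<^sub>0 (T\<^sub>0 X)) \<odot> T\<^sub>1 (l (T\<^sub>0 X))) \<odot> l (T\<^sub>0 ?Y)"
      by (simp only: T.monad_laws(3) that)
    also have "\<dots> = \<mu> (T\<^sub>0 X)
        \<odot> P\<^sub>1 (P\<^sub>1 (m X) \<odot> (P\<^sub>1 (m (T\<^sub>0 X)) \<odot> l (T\<^sub>0 (T\<^sub>0 X)) \<odot> T\<^sub>1 (l (T\<^sub>0 X)))) \<odot> l (T\<^sub>0 ?Y)"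
      by simp
    \<comment> \<open>The multiplication axiom for \<open>T\<close>, read from right to left. The
      \<open>m ?Y\<close> it produces, under \<open>P\<close>, joins \<open>l (T\<^sub>0 ?Y)\<close>
      to form \<open>to_extension ?Y\<close>.\<close>
    also have "\<dots> = \<mu> (T\<^sub>0 X) \<odot> P\<^sub>1 (P\<^sub>1 (m X) \<odot> (l (T\<^sub>0 X) \<odot> m ?Y)) \<odot> l (T\<^sub>0 ?Y)"
      using law_components(3)[of "T\<^sub>0 X"] by simp
    also have "\<dots> = \<mu> (T\<^sub>0 X) \<odot> P\<^sub>1 ?a \<odot> to_extension ?Y"
      by (simp add: to_extension_component)
    finally show ?thesis .
  qed
  show ?thesis
    by unfold_locales (auto simp: trans_defs unit preserves_unit preserves_extension)
qed

text \<open>Naturality of \<open>l\<close> at \<open>u X\<close> turns \<open>TPu\<close> into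
  \<open>PTu\<close>, which \<open>Pm\<close> cancels by the right unit law of
  \<open>T\<close>.\<close>

lemma to_extension_inverse: "to_extension \<cdot> ((T \<circ>\<^sub>F P) \<triangleright> u) = l"
proof (rule extensionalityI[OF _ extensional])
  fix X assume [simp]: "X \<in> Obj C"
  have 1: "P\<^sub>1 (m X) \<odot> P\<^sub>1 (T\<^sub>1 (u X)) = \<one> (P\<^sub>0 (T\<^sub>0 X))"
    using arg_cong[OF T.monad_laws(2)[of X], of P\<^sub>1] by simp
  show "(to_extension \<cdot> ((T \<circ>\<^sub>F P) \<triangleright> u)) X = l X"
    using natural[of "u X"] by (simp add: trans_defs to_extension_component comp_eq_comp[OF 1])
qed (simp add: vert_comp_def)

end

section \<open>The two constructions as mutually inverse maps\<close>

theorem mainTheorem5: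
  fixes C :: "('o, 'a) category_data" (structure)
    and T P :: "('o, 'a) functor_data"
    and u m \<eta> \<mu> :: "'o \<Rightarrow> 'a"
  assumes "category C"
    and "monad C T u m"
    and "monad C P \<eta> \<mu>"
  shows "bij_betw (\<lambda>l. (P \<triangleright> m) \<cdot> (l \<triangleleft> T))
    {l. distributive_law C T u m P \<eta> \<mu> l}
    {\<alpha>. nat_trans C (T \<circ>\<^sub>F P \<circ>\<^sub>F T) (P \<circ>\<^sub>F T) \<alpha>
      \<and> \<alpha> \<cdot> (u \<triangleleft> (P \<circ>\<^sub>F T)) = id_trans C (P \<circ>\<^sub>F T)
      \<and> \<alpha> \<cdot> (T \<triangleright> (\<eta> \<triangleleft> T)) = (\<eta> \<triangleleft> T) \<cdot> m
      \<and> \<alpha> \<cdot> (T \<triangleright> (\<mu> \<triangleleft> T)) \<cdot> ((T \<circ>\<^sub>F P) \<triangleright> \<alpha>)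
          = (\<mu> \<triangleleft> T) \<cdot> (P \<triangleright> \<alpha>) \<cdot> (\<alpha> \<triangleleft> (P \<circ>\<^sub>F T))}"
proof -
  have pair: "monad_pair C T u m P \<eta> \<mu>"
    using assms by (simp add: monad_pair_def)
  have law: "law C T u m P \<eta> \<mu> l" if "distributive_law C T u m P \<eta> \<mu> l" for l
    using pair that by (simp add: law_def)
  have "bij_betw (\<lambda>l. (P \<triangleright> m) \<cdot> (l \<triangleleft> T))
    {l. distributive_law C T u m P \<eta> \<mu> l} {\<alpha>. extension_law C T u m P \<eta> \<mu> \<alpha>}"
  proof (rule bij_betw_byWitness[where f' = "\<lambda>\<alpha>. \<alpha> \<cdot> ((T \<circ>\<^sub>F P) \<triangleright> u)"]; safe)
    fix l assume l: "distributive_law C T u m P \<eta> \<mu> l"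
    interpret law C T u m P \<eta> \<mu> l
      using l by (rule law)
    show "((P \<triangleright> m) \<cdot> (l \<triangleleft> T)) \<cdot> ((T \<circ>\<^sub>F P) \<triangleright> u) = l"
      using to_extension_inverse by (simp add: to_extension_def)
    show "extension_law C T u m P \<eta> \<mu> ((P \<triangleright> m) \<cdot> (l \<triangleleft> T))"
      using to_extension_law by (simp add: to_extension_def)
  next
    fix \<alpha> assume "extension_law C T u m P \<eta> \<mu> \<alpha>"
    then interpret extension_law C T u m P \<eta> \<mu> \<alpha> .
    show "(P \<triangleright> m) \<cdot> ((\<alpha> \<cdot> ((T \<circ>\<^sub>F P) \<triangleright> u)) \<triangleleft> T) = \<alpha>"
      using to_law_inverse by (simp add: to_law_def)
    show "distributive_law C T u m P \<eta> \<mu> (\<alpha> \<cdot> ((T \<circ>\<^sub>F P) \<triangleright> u))"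
      using to_law_distributive by (simp add: to_law_def)
  qed
  \<comment> \<open>Given the two monads, \<open>extension_law\<close> unfolds to naturality of
    \<alpha> together with the three equations.\<close>
  then show ?thesis
    using pair by (simp add: extension_law_def extension_law_axioms_def)
qed

end
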